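(* Let $g_0(\rho)$, $\delta(\tau,\rho)$ and $\vartheta(t,\rho)$ be as defined in the context. Assume that for all $\tau>0$ and all $\rho>0$ $$|\delta(\tau,\rho)|\le 1\qquad\text{and}\qquad |\delta(\tau,\rho)|\le\frac{1}{35}\,\tau .$$ Then $|\vartheta(t,\rho)|\le\vartheta_{\max}(t)$ for all $t>0$ and all $\rho>0$, where $$\vartheta_{\max}(t)=\frac{1}{70}\,t-\sqrt{\frac{35}{\pi t}}\;\mathrm{Ei}_{-1/2}\!\Big(\frac{35}{t}\Big)+\operatorname{erfc}\!\Big(\sqrt{\frac{35}{t}}\Big).$$ Moreover $\vartheta_{\max}(t)\to 1$ as $t\to\infty$.
   Context: For $\rho>0$ let $$h(\xi)=\tfrac12\xi^2+\rho\cosh\xi-i\pi\xi,\qquad g(\xi,\rho)=\frac{\sinh\xi}{\xi+\rho\sinh\xi-i\pi}\qquad(\xi\in\mathbb C).$$ Saddle point $X=X(\rho)$ of $h$: - if $0<\rho<1$, $X=x_1+i\pi$, where $x_1>0$ is the solution of $\rho\,\frac{\sinh x_1}{x_1}=1$; - if $\rho=1$, $X=i\pi$; - if $\rho>1$, $X=iy_1$, where $y_1\in(0,\pi)$ is the solution of $y_1+\rho\sin y_1=\pi$. Steepest descent path: $\xi(\tau)$, $\tau\ge 0$, is the continuous curve with $\xi(0)=X$, $h(\xi(\tau))-h(X)=\tau$ (so $\tau$ is a real parameter along the path), which for $\tau>0$ lies in the half-strip $\{\operatorname{Re}\xi>0,\ 0<\operatorname{Im}\xi<\pi\}$ and satisfies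 $\operatorname{Re}\xi(\tau)\to+\infty$ as $\tau\to\infty$. For $\tau>0$ write $g(\tau,\rho):=g(\xi(\tau),\rho)$. The coefficient $g_0(\rho)$ of $\tau^{-1/2}$ in the expansion of $\operatorname{Im} g(\tau,\rho)$ as $\tau\to0^+$ is $$g_0(\rho)=\begin{cases}\dfrac{\sinh x_1}{\sqrt{2(\rho\cosh x_1-1)}}, & 0<\rho<1,\\[2mm] \sqrt{3/2}, & \rho=1,\\[1mm] \dfrac{\sin y_1}{\sqrt{2(\rho\cos y_1+1)}}, & \rho>1.\end{cases}$$ The function $\delta(\tau,\rho)$ is defined for $\tau>0$ by $$\operatorname{Im} g(\tau,\rho)=g_0(\rho)\,\frac{1}{\sqrt\tau}\,\bigl(1+\delta(\tau,\rho)\bigr),$$ and $\vartheta(t,\rho)$ is defined for $t>0$ by $$\operatorname{Im}\int_0^\infty e^{-\tau/t}\,g(\tau,\rho)\,d\tau=\sqrt{\pi t}\;g_0(\rho)\,\bigl(1+\vartheta(t,\rho)\bigr).$$ Special functions: $\mathrm{Ei}_\alpha(z)=\int_1^\infty e^{-zs}s^{-\alpha}\,ds$ for $z>0$, and $\operatorname{erfc}(z)=\frac{2}{\sqrt\pi}\int_z^\infty e^{-s^2}ds$. *)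

theory Defs
  imports "HOL-Analysis.Analysis" "HOL-Real_Asymp.Real_Asymp"
begin

definition hfun :: "real \<Rightarrow> complex \<Rightarrow> complex" where
  "hfun \<rho> \<xi> = \<xi>\<^sup>2 / 2 + of_real \<rho> * cosh \<xi> - \<i> * of_real pi * \<xi>"

definition gfun :: "complex \<Rightarrow> real \<Rightarrow> complex" where
  "gfun \<xi> \<rho> = sinh \<xi> / (\<xi> + of_real \<rho> * sinh \<xi> - \<i> * of_real pi)"

(* Meaningful for 0 < rho < 1 only; see x1_ex1. *)
definition x1 :: "real \<Rightarrow> real" where
  "x1 \<rho> = (THE x. x > 0 \<and> \<rho> * (sinh x / x) = 1)"

(* Meaningful for rho > 1 only; see y1_ex1. *)
definition y1 :: "real \<Rightarrow> real" where
  "y1 \<rho> = (THE y. y \<in> {0<..<pi} \<and> y + \<rho> * sin y = pi)"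

definition saddle :: "real \<Rightarrow> complex" where
  "saddle \<rho> =
     (if \<rho> < 1 then of_real (x1 \<rho>) + \<i> * of_real pi
      else if \<rho> = 1 then \<i> * of_real pi
      else \<i> * of_real (y1 \<rho>))"

definition steepest_descent_path :: "real \<Rightarrow> (real \<Rightarrow> complex) \<Rightarrow> bool" where
  "steepest_descent_path \<rho> \<xi> \<longleftrightarrow>
     continuous_on {0..} \<xi> \<and>
     \<xi> 0 = saddle \<rho> \<and>
     (\<forall>\<tau>\<ge>0. hfun \<rho> (\<xi> \<tau>) - hfun \<rho> (saddle \<rho>) = of_real \<tau>) \<and>
     (\<forall>\<tau>>0. Re (\<xi> \<tau>) > 0 \<and> 0 < Im (\<xi> \<tau>) \<and> Im (\<xi> \<tau>) < pi) \<and>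
     filterlim (\<lambda>\<tau>. Re (\<xi> \<tau>)) at_top at_top"

definition g0 :: "real \<Rightarrow> real" where
  "g0 \<rho> =
     (if \<rho> < 1 then sinh (x1 \<rho>) / sqrt (2 * (\<rho> * cosh (x1 \<rho>) - 1))
      else if \<rho> = 1 then sqrt (3 / 2)
      else sin (y1 \<rho>) / sqrt (2 * (\<rho> * cos (y1 \<rho>) + 1)))"

(* In delta and vartheta the argument xi is a family of paths, xi rho being the path for the
   parameter rho. Both functions are given by solving their defining relations, which is
   possible since g0 rho > 0; the relations themselves are delta_eq and vartheta_eq below. *)
definition delta :: "(real \<Rightarrow> real \<Rightarrow> complex) \<Rightarrow> real \<Rightarrow> real \<Rightarrow> real" where
  "delta \<xi> \<tau> \<rho> = Im (gfun (\<xi> \<rho> \<tau>) \<rho>) / (g0 \<rho> * (1 / sqrt \<tau>)) - 1"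

definition vartheta :: "(real \<Rightarrow> real \<Rightarrow> complex) \<Rightarrow> real \<Rightarrow> real \<Rightarrow> real" where
  "vartheta \<xi> t \<rho> =
     Im (LBINT \<tau>:{0<..}. of_real (exp (- \<tau> / t)) * gfun (\<xi> \<rho> \<tau>) \<rho>)
       / (sqrt (pi * t) * g0 \<rho>) - 1"

definition Ei :: "real \<Rightarrow> real \<Rightarrow> real" where
  "Ei \<alpha> z = (LBINT s:{1..}. exp (- z * s) * s powr (- \<alpha>))"

definition erfc :: "real \<Rightarrow> real" where
  "erfc z = 2 / sqrt pi * (LBINT s:{z..}. exp (- s\<^sup>2))"

definition vartheta_max :: "real \<Rightarrow> real" where
  "vartheta_max t = t / 70 - sqrt (35 / (pi * t)) * Ei (- 1 / 2) (35 / t) + erfc (sqrt (35 / t))"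

lemma sinh_less_x_cosh:
  fixes x :: real
  assumes "x > 0"
  shows "sinh x < x * cosh x"
proof -
  have "(\<lambda>x::real. x * cosh x - sinh x) 0 < (\<lambda>x::real. x * cosh x - sinh x) x"
  proof (rule DERIV_pos_imp_increasing_open[OF assms])
    fix z :: real assume "0 < z" "z < x"
    have "((\<lambda>x::real. x * cosh x - sinh x) has_real_derivative z * sinh z) (at z)"
      by (auto intro!: derivative_eq_intros)
    then show "\<exists>y. ((\<lambda>x::real. x * cosh x - sinh x) has_real_derivative y) (at z) \<and> 0 < y"
      using \<open>0 < z\<close> by (intro exI[of _ "z * sinh z"]) auto
  qed (auto intro!: continuous_intros)
  then show ?thesis by simp
qed

lemma x1_ex1:
  fixes \<rho> :: real
  assumes "0 < \<rho>" "\<rho> < 1"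
  shows "\<exists>!x. x > 0 \<and> \<rho> * (sinh x / x) = 1"
proof -
  have mono: "\<rho> * (sinh a / a) < \<rho> * (sinh b / b)" if "0 < a" "a < b" for a b :: real
  proof (rule DERIV_pos_imp_increasing_open[OF \<open>a < b\<close>])
    fix x assume "a < x" "x < b"
    with that have x: "x > 0" by simp
    have "((\<lambda>x. \<rho> * (sinh x / x)) has_real_derivative \<rho> * ((cosh x * x - sinh x) / (x * x))) (at x)"
      using x by (auto intro!: derivative_eq_intros simp: algebra_simps)
    moreover have "\<rho> * ((cosh x * x - sinh x) / (x * x)) > 0"
      using x assms sinh_less_x_cosh[OF x] by (simp add: mult.commute)
    ultimately show "\<exists>y. ((\<lambda>x. \<rho> * (sinh x / x)) has_real_derivative y) (at x) \<and> 0 < y" by blast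
  qed (use that in \<open>auto intro!: continuous_intros\<close>)
  have "((\<lambda>x::real. sinh x / x) \<longlongrightarrow> 1) (at_right 0)" unfolding sinh_field_def by real_asymp
  then have "eventually (\<lambda>x::real. sinh x / x < 1 / \<rho>) (at_right 0)"
    by (rule order_tendstoD) (use assms in auto)
  moreover have "eventually (\<lambda>x::real. x \<in> {0<..<1}) (at_right 0)"
    by (rule eventually_at_right_real) simp
  ultimately have "eventually (\<lambda>x::real. sinh x / x < 1 / \<rho> \<and> x \<in> {0<..<1}) (at_right 0)"
    by eventually_elim auto
  then obtain a where a: "sinh a / a < 1 / \<rho>" "0 < a" "a < 1"
    using eventually_happens trivial_limit_at_right_real by (metis (no_types, lifting) greaterThanLessThan_iff)
  have "filterlim (\<lambda>x::real. sinh x / x) at_top at_top" unfolding sinh_field_def by real_asymp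
  then have "eventually (\<lambda>x::real. 1 / \<rho> < sinh x / x) at_top"
    by (simp add: filterlim_at_top_dense)
  then have "eventually (\<lambda>x::real. 1 / \<rho> < sinh x / x \<and> x > 1) at_top"
    using eventually_gt_at_top by (rule eventually_conj)
  then obtain b where b: "1 / \<rho> < sinh b / b" "b > 1"
    by (metis (no_types, lifting) eventually_happens trivial_limit_at_top_linorder)
  have "\<exists>x. a \<le> x \<and> x \<le> b \<and> sinh x / x = 1 / \<rho>"
    by (rule IVT') (use a b in \<open>auto intro!: continuous_intros\<close>)
  then obtain x where x: "x > 0" "sinh x / x = 1 / \<rho>" using a(2) less_le_trans by blast
  show ?thesis
  proof (rule ex1I[of _ x])
    show "x > 0 \<and> \<rho> * (sinh x / x) = 1" using x assms by simp
    fix z assume "z > 0 \<and> \<rho> * (sinh z / z) = 1"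
    then show "z = x" using mono[of x z] mono[of z x] x assms
      by (cases z x rule: linorder_cases) auto
  qed
qed

lemma x_cos_less_sin:
  fixes u :: real
  assumes "0 < u" "u < pi"
  shows "u * cos u < sin u"
proof -
  have "(\<lambda>x::real. sin x - x * cos x) 0 < (\<lambda>x::real. sin x - x * cos x) u"
  proof (rule DERIV_pos_imp_increasing_open[OF assms(1)])
    fix z :: real assume "0 < z" "z < u"
    have "((\<lambda>x::real. sin x - x * cos x) has_real_derivative z * sin z) (at z)"
      by (auto intro!: derivative_eq_intros)
    then show "\<exists>y. ((\<lambda>x::real. sin x - x * cos x) has_real_derivative y) (at z) \<and> 0 < y"
      using \<open>0 < z\<close> \<open>z < u\<close> assms by (intro exI[of _ "z * sin z"]) (auto intro!: mult_pos_pos sin_gt_zero)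
  qed (auto intro!: continuous_intros)
  then show ?thesis by simp
qed

lemma y1_ex1:
  fixes \<rho> :: real
  assumes "\<rho> > 1"
  shows "\<exists>!y. y \<in> {0<..<pi} \<and> y + \<rho> * sin y = pi"
proof -
  have mono: "a / sin a < b / sin b" if "0 < a" "a < b" "b < pi" for a b :: real
  proof (rule DERIV_pos_imp_increasing_open[OF \<open>a < b\<close>])
    fix x assume "a < x" "x < b"
    with that have x: "x > 0" "x < pi" by simp_all
    have s: "sin x > 0" using x by (rule sin_gt_zero)
    have "((\<lambda>x. x / sin x) has_real_derivative (sin x - x * cos x) / (sin x * sin x)) (at x)"
      using s by (auto intro!: derivative_eq_intros)
    moreover have "(sin x - x * cos x) / (sin x * sin x) > 0"
      using s x_cos_less_sin[OF x] by simp
    ultimately show "\<exists>y. ((\<lambda>x. x / sin x) has_real_derivative y) (at x) \<and> 0 < y" by blast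
  next
    have "sin x \<noteq> 0" if "x \<in> {a..b}" for x
      using sin_gt_zero[of x] that \<open>0 < a\<close> \<open>b < pi\<close> by force
    then show "continuous_on {a..b} (\<lambda>x. x / sin x)" by (auto intro!: continuous_intros)
  qed
  have "((\<lambda>u::real. u / sin u) \<longlongrightarrow> 1) (at_right 0)" by real_asymp
  then have "eventually (\<lambda>u::real. u / sin u < \<rho>) (at_right 0)"
    by (rule order_tendstoD) (use assms in auto)
  moreover have "eventually (\<lambda>u::real. u \<in> {0<..<pi}) (at_right 0)"
    by (rule eventually_at_right_real) simp
  ultimately have "eventually (\<lambda>u::real. u / sin u < \<rho> \<and> u \<in> {0<..<pi}) (at_right 0)"
    by eventually_elim auto
  then obtain a where a: "a / sin a < \<rho>" "0 < a" "a < pi"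
    using eventually_happens trivial_limit_at_right_real by (metis (no_types, lifting) greaterThanLessThan_iff)
  then have a': "a < \<rho> * sin a"
    by (simp add: divide_less_eq sin_gt_zero)
  have "\<exists>u. a \<le> u \<and> u \<le> pi \<and> u - \<rho> * sin u = 0"
    by (rule IVT') (use a a' in \<open>auto intro!: continuous_intros\<close>)
  then obtain u where u: "a \<le> u" "u \<le> pi" "u = \<rho> * sin u" by auto
  then have "u \<noteq> pi" by auto
  with u a have u': "0 < u" "u < pi" by auto
  show ?thesis
  proof (rule ex1I[of _ "pi - u"])
    show "pi - u \<in> {0<..<pi} \<and> pi - u + \<rho> * sin (pi - u) = pi" using u u' by simp
    fix z assume z: "z \<in> {0<..<pi} \<and> z + \<rho> * sin z = pi"
    then have "(pi - z) / sin (pi - z) = \<rho>"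
      using sin_gt_zero[of z] by (simp add: field_simps)
    moreover have "u / sin u = \<rho>"
      using u(3) sin_gt_zero[OF u'] by (simp add: field_simps)
    ultimately show "z = pi - u"
      using mono[of u "pi - z"] mono[of "pi - z" u] u' z
      by (cases "pi - z" u rule: linorder_cases) auto
  qed
qed

lemma g0_pos:
  assumes "\<rho> > 0"
  shows "g0 \<rho> > 0"
proof -
  consider "\<rho> < 1" | "\<rho> = 1" | "\<rho> > 1" by linarith
  then show ?thesis
  proof cases
    case 1
    have x: "x1 \<rho> > 0" "\<rho> * (sinh (x1 \<rho>) / x1 \<rho>) = 1"
      using theI'[OF x1_ex1[OF assms 1]] unfolding x1_def by auto
    have "\<rho> * (sinh (x1 \<rho>) / x1 \<rho>) < \<rho> * cosh (x1 \<rho>)"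
      using assms x(1) sinh_less_x_cosh[OF x(1)] by (simp add: divide_less_eq mult.commute)
    with x 1 show ?thesis by (simp add: g0_def)
  next
    case 2
    then show ?thesis by (simp add: g0_def)
  next
    case 3
    have y: "0 < y1 \<rho>" "y1 \<rho> < pi" "y1 \<rho> + \<rho> * sin (y1 \<rho>) = pi"
      using theI'[OF y1_ex1[OF 3]] unfolding y1_def by auto
    define u where "u = pi - y1 \<rho>"
    have u: "0 < u" "u < pi" "u = \<rho> * sin u" using y by (simp_all add: u_def)
    have s: "sin u > 0" using u by (simp add: sin_gt_zero)
    have "sin u * (\<rho> * cos u) < sin u * 1"
      using x_cos_less_sin[OF u(1,2)] u(3) by (metis mult.assoc mult.commute mult_1_right)
    then have "\<rho> * cos u < 1" using s by (simp only: mult_less_cancel_left_pos)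
    moreover have "cos u = - cos (y1 \<rho>)" "sin u = sin (y1 \<rho>)" by (simp_all add: u_def)
    ultimately show ?thesis using s 3 by (simp add: g0_def)
  qed
qed

lemma delta_eq:
  assumes "\<rho> > 0" "\<tau> > 0"
  shows "Im (gfun (\<xi> \<rho> \<tau>) \<rho>) = g0 \<rho> * (1 / sqrt \<tau>) * (1 + delta \<xi> \<tau> \<rho>)"
  using g0_pos[OF assms(1)] assms(2) by (simp add: delta_def)

lemma vartheta_eq:
  assumes "\<rho> > 0" "t > 0"
  shows "Im (LBINT \<tau>:{0<..}. of_real (exp (- \<tau> / t)) * gfun (\<xi> \<rho> \<tau>) \<rho>) =
    sqrt (pi * t) * g0 \<rho> * (1 + vartheta \<xi> t \<rho>)"
  using g0_pos[OF assms(1)] assms(2) by (simp add: vartheta_def)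

end

theory Submission
  imports Defs "HOL-Complex_Analysis.Conformal_Mappings"
begin

text \<open>Since the integral of \<open>exp (- \<tau> / t) / sqrt \<tau>\<close> over the positive half-line is \<open>sqrt (pi * t)\<close>, the function
  \<open>vartheta\<close> is the average of \<open>delta\<close> against this weight, so it is bounded by the average of
  \<open>min 1 (\<tau> / 35)\<close>. Splitting the latter at \<open>\<tau> = 35\<close> gives exactly \<open>vartheta_max\<close>, and its limit is 1 because
  the weight spreads out to infinity as \<open>t\<close> grows. Absolute convergence of the complex integral comes
  from \<open>\<bar>h'\<bar> \<ge> c * \<tau> powr (1 - 1 / n)\<close> near a saddle point where \<open>h\<close> takes its value with multiplicity \<open>n\<close>, from
  the absence of critical points of \<open>h\<close> in the open half-strip, and from the boundedness of \<open>g\<close> far to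
  the right.\<close>

section \<open>Substitution in integrals with respect to \<open>lborel\<close>\<close>

text \<open>Absolute integrability refers to the completed measure, and completion does not affect
  the integrability of a Borel function.\<close>

lemma absolutely_integrable_on_iff_set_integrable_lborel:
  fixes f :: "real \<Rightarrow> real"
  assumes "f \<in> borel_measurable borel" "A \<in> sets borel"
  shows "f absolutely_integrable_on A \<longleftrightarrow> set_integrable lborel A f"
  unfolding set_integrable_def using assms by (intro integrable_completion) auto

text \<open>The change of variables for injective differentiable maps, which is about the completed
  measure, is carried over to \<open>lborel\<close> by the preceding equivalence. Whole rays can be
  substituted at once, without limits over compact intervals.\<close>

lemma set_integral_substitution_lborel:
  fixes f g g' :: "real \<Rightarrow> real"
  assumes meas: "f \<in> borel_measurable borel" "g \<in> borel_measurable borel" "g' \<in> borel_measurable borel"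
    and sets: "S \<in> sets borel" "g ` S \<in> sets borel"
    and deriv: "\<And>x. x \<in> S \<Longrightarrow> (g has_field_derivative g' x) (at x within S)"
    and inj: "inj_on g S"
    and int: "set_integrable lborel (g ` S) f"
  shows "set_integrable lborel S (\<lambda>x. \<bar>g' x\<bar> * f (g x))"
    and "(LBINT x:S. \<bar>g' x\<bar> * f (g x)) = (LBINT x:g ` S. f x)"
proof -
  have "f absolutely_integrable_on g ` S"
    using int meas sets by (simp add: absolutely_integrable_on_iff_set_integrable_lborel)
  with has_absolute_integral_change_of_variables_1'[OF _ deriv inj, of f "integral (g ` S) f"] sets
  have sub: "(\<lambda>x. \<bar>g' x\<bar> * f (g x)) absolutely_integrable_on S"
    "integral S (\<lambda>x. \<bar>g' x\<bar> * f (g x)) = integral (g ` S) f"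
    by auto
  from sub(1) show S: "set_integrable lborel S (\<lambda>x. \<bar>g' x\<bar> * f (g x))"
    using meas sets by (subst (asm) absolutely_integrable_on_iff_set_integrable_lborel) auto
  show "(LBINT x:S. \<bar>g' x\<bar> * f (g x)) = (LBINT x:g ` S. f x)"
    using sub(2) set_borel_integral_eq_integral(2)[OF S] set_borel_integral_eq_integral(2)[OF int]
    by simp
qed

section \<open>Laplace integrals of powers and their tails\<close>

lemma Gamma_integral_lborel:
  fixes a :: real
  assumes "a > 0"
  shows "set_integrable lborel {0<..} (\<lambda>u. u powr (a - 1) * exp (- u))"
    and "(LBINT u:{0<..}. u powr (a - 1) * exp (- u)) = Gamma a"
proof -
  have "((\<lambda>u. u powr (a - 1) * exp (- u)) has_integral Gamma a) {0..}"
    using Gamma_integral_real[OF assms] by (simp add: exp_minus field_simps)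
  \<comment> \<open>The closed and the open half-line differ only in the null set containing
    0.\<close>
  then have I: "((\<lambda>u. u powr (a - 1) * exp (- u)) has_integral Gamma a) {0<..}"
    by (rule has_integral_spike_set_eq[THEN iffD1, rotated -1])
      (auto intro: negligible_subset[of "{0}"] negligible_subset[of "{}"])
  then have "(\<lambda>u. u powr (a - 1) * exp (- u)) absolutely_integrable_on {0<..}"
    by (intro nonnegative_absolutely_integrable_1) (auto simp: integrable_on_def)
  then show S: "set_integrable lborel {0<..} (\<lambda>u. u powr (a - 1) * exp (- u))"
    by (subst (asm) absolutely_integrable_on_iff_set_integrable_lborel) auto
  show "(LBINT u:{0<..}. u powr (a - 1) * exp (- u)) = Gamma a"
    using set_borel_integral_eq_integral(2)[OF S] integral_unique[OF I] by simp
qed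

text \<open>Substitute \<open>u = \<tau> / t\<close> in Euler's integral for Gamma. The exponents
  1/2 and 3/2 later give the mass and the first moment of the weight; other exponents serve in
  dominating functions.\<close>

lemma Laplace_powr:
  fixes a t :: real
  assumes a: "a > 0" and t: "t > 0"
  shows "set_integrable lborel {0<..} (\<lambda>\<tau>. exp (- \<tau> / t) * \<tau> powr (a - 1))"
    and "(LBINT \<tau>:{0<..}. exp (- \<tau> / t) * \<tau> powr (a - 1)) = Gamma a * t powr a"
proof -
  have img: "(\<lambda>\<tau>. \<tau> / t) ` {0<..} = {0<..}"
  proof (intro equalityI subsetI)
    fix y :: real assume "y \<in> {0<..}"
    then show "y \<in> (\<lambda>\<tau>. \<tau> / t) ` {0<..}" using t by (intro image_eqI[of _ _ "y * t"]) auto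
  qed (use t in auto)
  have eq: "\<bar>1 / t\<bar> * ((\<tau> / t) powr (a - 1) * exp (- (\<tau> / t))) =
      t powr - a * (exp (- \<tau> / t) * \<tau> powr (a - 1))" if "\<tau> \<in> {0<..}" for \<tau>
    using that t by (simp add: powr_divide powr_diff powr_minus field_simps)
  have deriv: "((\<lambda>\<tau>. \<tau> / t) has_field_derivative 1 / t) (at \<tau> within {0<..})" for \<tau>
    using t by (auto intro!: derivative_eq_intros)
  note sub = set_integral_substitution_lborel[where f = "\<lambda>u. u powr (a - 1) * exp (- u)"
      and g = "\<lambda>\<tau>. \<tau> / t" and g' = "\<lambda>_. 1 / t" and S = "{0<..}", unfolded img,
      OF _ _ _ _ _ deriv _ Gamma_integral_lborel(1)[OF a]]
  have inj: "inj_on (\<lambda>\<tau>. \<tau> / t) {0<..}"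
    using t by (auto intro!: inj_onI)
  have "set_integrable lborel {0<..} (\<lambda>\<tau>. \<bar>1 / t\<bar> * ((\<tau> / t) powr (a - 1) * exp (- (\<tau> / t))))"
    by (rule sub(1)) (use inj in auto)
  also have "?this \<longleftrightarrow> set_integrable lborel {0<..} (\<lambda>\<tau>. t powr - a * (exp (- \<tau> / t) * \<tau> powr (a - 1)))"
    by (rule set_integrable_cong) (use eq in auto)
  finally show I: "set_integrable lborel {0<..} (\<lambda>\<tau>. exp (- \<tau> / t) * \<tau> powr (a - 1))"
    using t by (subst (asm) set_integrable_mult_right_iff) auto
  have "(LBINT \<tau>:{0<..}. \<bar>1 / t\<bar> * ((\<tau> / t) powr (a - 1) * exp (- (\<tau> / t)))) = Gamma a"
    unfolding Gamma_integral_lborel(2)[OF a, symmetric] by (rule sub(2)) (use inj in auto)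
  also have "(LBINT \<tau>:{0<..}. \<bar>1 / t\<bar> * ((\<tau> / t) powr (a - 1) * exp (- (\<tau> / t)))) =
      (LBINT \<tau>:{0<..}. t powr - a * (exp (- \<tau> / t) * \<tau> powr (a - 1)))"
    by (rule set_lebesgue_integral_cong) (use eq in auto)
  finally show "(LBINT \<tau>:{0<..}. exp (- \<tau> / t) * \<tau> powr (a - 1)) = Gamma a * t powr a"
    using t by (simp add: powr_minus field_simps)
qed

lemma set_integrable_Laplace_powr_Ici:
  fixes a c t :: real
  assumes "a > 0" "c > 0" "t > 0"
  shows "set_integrable lborel {c..} (\<lambda>\<tau>. exp (- \<tau> / t) * \<tau> powr (a - 1))"
  by (rule set_integrable_subset[OF Laplace_powr(1)]) (use assms in auto)

text \<open>The substitution \<open>\<tau> = c * s\<close> moves the lower limit to 1, which is the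
  form of \<open>Ei\<close>.\<close>

lemma Laplace_powr_Ici_eq_Ei:
  fixes a c t :: real
  assumes a: "a > 0" and c: "c > 0" and t: "t > 0"
  shows "(LBINT \<tau>:{c..}. exp (- \<tau> / t) * \<tau> powr (a - 1)) = c powr a * Ei (1 - a) (c / t)"
proof -
  have img: "(\<lambda>s. c * s) ` {1..} = {c..}"
  proof (intro equalityI subsetI)
    fix y :: real assume "y \<in> {c..}"
    then show "y \<in> (\<lambda>s. c * s) ` {1..}" using c by (intro image_eqI[of _ _ "y / c"]) auto
  qed (use c in auto)
  have deriv: "((\<lambda>s. c * s) has_field_derivative c) (at s within {1..})" for s
    by (auto intro!: derivative_eq_intros)
  have inj: "inj_on (\<lambda>s. c * s) {1..}"
    using c by (auto intro!: inj_onI)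
  have "(LBINT \<tau>:{c..}. exp (- \<tau> / t) * \<tau> powr (a - 1)) =
      (LBINT s:{1..}. \<bar>c\<bar> * (exp (- (c * s) / t) * (c * s) powr (a - 1)))"
    unfolding img[symmetric]
    by (rule set_integral_substitution_lborel(2)[symmetric])
      (use inj deriv img set_integrable_Laplace_powr_Ici[OF assms] in auto)
  also have "\<dots> = (LBINT s:{1..}. c powr a * (exp (- (c / t) * s) * s powr (- (1 - a))))"
    using c by (intro set_lebesgue_integral_cong) (auto simp: powr_mult powr_diff field_simps)
  finally show ?thesis by (simp add: Ei_def)
qed

text \<open>With \<open>\<tau> = t * s\<^sup>2\<close> the singular factor is absorbed, since the
  derivative divided by \<open>sqrt \<tau>\<close> is the constant \<open>2 * sqrt t\<close>; a
  Gaussian tail remains.\<close>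

lemma Laplace_inverse_sqrt_Ici_eq_erfc:
  fixes c t :: real
  assumes c: "c > 0" and t: "t > 0"
  shows "(LBINT \<tau>:{c..}. exp (- \<tau> / t) * \<tau> powr (1 / 2 - 1)) = sqrt (pi * t) * erfc (sqrt (c / t))"
proof -
  have img: "(\<lambda>s. t * s\<^sup>2) ` {sqrt (c / t)..} = {c..}"
  proof (intro equalityI subsetI)
    fix y :: real assume "y \<in> {c..}"
    then show "y \<in> (\<lambda>s. t * s\<^sup>2) ` {sqrt (c / t)..}"
      using c t by (intro image_eqI[of _ _ "sqrt (y / t)"]) (auto simp: divide_right_mono)
  next
    fix y :: real assume "y \<in> (\<lambda>s. t * s\<^sup>2) ` {sqrt (c / t)..}"
    then obtain s where s: "y = t * s\<^sup>2" "sqrt (c / t) \<le> s" by auto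
    then have "c / t \<le> s\<^sup>2" by (rule_tac sqrt_le_D)
    then show "y \<in> {c..}" using s t by (simp add: field_simps)
  qed
  \<comment> \<open>A positive lower limit makes squaring injective on the ray and removes the
    absolute value from the derivative.\<close>
  have spos: "s > 0" if "sqrt (c / t) \<le> s" for s
    using c t that less_le_trans[of 0 "sqrt (c / t)" s] by simp
  have deriv: "((\<lambda>s. t * s\<^sup>2) has_field_derivative 2 * t * s) (at s within {sqrt (c / t)..})" for s
    by (auto intro!: derivative_eq_intros)
  have inj: "inj_on (\<lambda>s. t * s\<^sup>2) {sqrt (c / t)..}"
    using t spos by (auto intro!: inj_onI simp: power2_eq_iff_nonneg less_imp_le)
  have "(LBINT \<tau>:{c..}. exp (- \<tau> / t) * \<tau> powr (1 / 2 - 1)) =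
      (LBINT s:{sqrt (c / t)..}. \<bar>2 * t * s\<bar> * (exp (- (t * s\<^sup>2) / t) * (t * s\<^sup>2) powr (1 / 2 - 1)))"
    unfolding img[symmetric]
    by (rule set_integral_substitution_lborel(2)[symmetric])
      (use inj deriv img set_integrable_Laplace_powr_Ici[of "1 / 2", OF _ assms] in auto)
  also have "\<dots> = (LBINT s:{sqrt (c / t)..}. (2 * sqrt t) * exp (- s\<^sup>2))"
  proof (intro set_lebesgue_integral_cong ballI allI impI)
    fix s assume "s \<in> {sqrt (c / t)..}"
    then have s: "s > 0" using spos by simp
    have "(t * s\<^sup>2) powr (1 / 2 - 1) = 1 / (sqrt t * s)"
      using s t powr_minus[of "t * s\<^sup>2" "1 / 2"]
      by (simp add: powr_half_sqrt real_sqrt_mult field_simps)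
    then have "\<bar>2 * t * s\<bar> * (exp (- (t * s\<^sup>2) / t) * (t * s\<^sup>2) powr (1 / 2 - 1)) =
        2 * (t / sqrt t) * exp (- s\<^sup>2)"
      using s t by simp
    then show "\<bar>2 * t * s\<bar> * (exp (- (t * s\<^sup>2) / t) * (t * s\<^sup>2) powr (1 / 2 - 1)) =
        (2 * sqrt t) * exp (- s\<^sup>2)"
      using t by (simp only: real_div_sqrt less_imp_le)
  qed auto
  finally show ?thesis
    using t by (simp add: erfc_def real_sqrt_mult)
qed

section \<open>The inverse derivative of a holomorphic function near a point\<close>

text \<open>If \<open>f z - f x\<close> vanishes to order \<open>n\<close> at \<open>x\<close>, it
  is comparable to the \<open>n\<close>-th power of \<open>z - x\<close> and the derivative to the
  power \<open>n - 1\<close>. Eliminating \<open>z - x\<close> gives the exponent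
  \<open>a - 1\<close> with \<open>a = 1 / n\<close>, which is above -1 and hence integrable at
  0.\<close>

lemma inverse_deriv_bound_near_point:
  fixes f :: "complex \<Rightarrow> complex"
  assumes hol: "f holomorphic_on S" and S: "open S" "connected S" and x: "x \<in> S"
    and nonconst: "\<not> f constant_on S"
  obtains a C r where "a > 0" "C > 0" "r > 0"
    "\<And>z. z \<in> ball x r \<Longrightarrow> z \<noteq> x \<Longrightarrow> norm (inverse (deriv f z)) \<le> C * norm (f z - f x) powr (a - 1)"
proof -
  define F where "F = (\<lambda>z. f z - f x)"
  have F: "F holomorphic_on S" "F x = 0"
    using hol by (auto simp: F_def intro!: holomorphic_intros)
  have "\<not> F constant_on S"
    using nonconst unfolding F_def constant_on_def by (metis diff_add_cancel)
  then obtain g r n where "0 < n" "0 < r" "ball x r \<subseteq> S" "g holomorphic_on ball x r"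
      "\<forall>w\<in>ball x r. F w = (w - x) ^ n * g w \<and> g w \<noteq> 0"
    using holomorphic_factor_zero_nonconstant[OF F(1) S x F(2)] by (metis (no_types, lifting))
  then have n: "0 < n" and r: "0 < r" "ball x r \<subseteq> S"
    and g: "g holomorphic_on ball x r"
      "\<And>w. w \<in> ball x r \<Longrightarrow> F w = (w - x) ^ n * g w"
      "\<And>w. w \<in> ball x r \<Longrightarrow> g w \<noteq> 0"
    by auto
  \<comment> \<open>The cofactor of the derivative after \<open>(z - x) ^ (n - 1)\<close> is split
    off; at \<open>x\<close> it equals \<open>n * g x\<close>, which is nonzero.\<close>
  define q where "q = (\<lambda>z. of_nat n * g z + (z - x) * deriv g z)"
  have deriv_f: "deriv f z = (z - x) ^ (n - 1) * q z" if z: "z \<in> ball x r" for z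
  proof -
    have dg: "(g has_field_derivative deriv g z) (at z)"
      using g(1) z by (rule holomorphic_derivI[OF _ open_ball])
    have "((\<lambda>w. (w - x) ^ n * g w) has_field_derivative
        of_nat n * (z - x) ^ (n - 1) * g z + (z - x) ^ n * deriv g z) (at z)"
      by (auto intro!: derivative_eq_intros dg)
    moreover have "of_nat n * (z - x) ^ (n - 1) * g z + (z - x) ^ n * deriv g z = (z - x) ^ (n - 1) * q z"
      using n by (cases n) (auto simp: q_def algebra_simps)
    ultimately have "((\<lambda>w. (w - x) ^ n * g w) has_field_derivative (z - x) ^ (n - 1) * q z) (at z)"
      by simp
    then have "(F has_field_derivative (z - x) ^ (n - 1) * q z) (at z)"
      by (rule has_field_derivative_transform_within_open[OF _ open_ball z]) (simp add: g(2))
    then have "((\<lambda>w. F w + f x) has_field_derivative (z - x) ^ (n - 1) * q z) (at z)"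
      by (auto intro!: derivative_eq_intros)
    then show ?thesis by (simp add: F_def DERIV_imp_deriv)
  qed
  have contg: "continuous_on (ball x r) g"
    using g(1) by (rule holomorphic_on_imp_continuous_on)
  have "continuous_on (ball x r) q"
    unfolding q_def using g(1) by (intro continuous_intros contg holomorphic_on_imp_continuous_on
        holomorphic_deriv open_ball)
  then have "isCont q x" "isCont g x"
    using contg r by (auto simp: continuous_on_eq_continuous_at)
  then have lim: "(q \<longlongrightarrow> q x) (at x)" "(g \<longlongrightarrow> g x) (at x)"
    by (auto simp: isCont_def)
  \<comment> \<open>Near \<open>x\<close>, \<open>m\<close> bounds \<open>q\<close> from below and
    \<open>M\<close> bounds \<open>g\<close> from above.\<close>
  define m where "m = norm (q x) / 2"
  define M where "M = norm (g x) + 1"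
  have gx: "g x \<noteq> 0" using g(3) r by simp
  then have m: "m > 0" using n by (simp add: m_def q_def)
  have M: "M > 0" by (simp add: M_def add_nonneg_pos)
  have "eventually (\<lambda>z. m < norm (q z)) (at x)"
    by (rule order_tendstoD[OF tendsto_norm[OF lim(1)]]) (use m in \<open>simp add: m_def\<close>)
  moreover have "eventually (\<lambda>z. norm (g z) < M) (at x)"
    by (rule order_tendstoD[OF tendsto_norm[OF lim(2)]]) (simp add: M_def)
  ultimately have "eventually (\<lambda>z. m < norm (q z) \<and> norm (g z) < M) (at x)"
    by (rule eventually_conj)
  then obtain s where s: "s > 0"
    "\<And>z. z \<noteq> x \<Longrightarrow> dist z x < s \<Longrightarrow> m < norm (q z) \<and> norm (g z) < M"
    unfolding eventually_at by auto
  \<comment> \<open>The constant \<open>C\<close> comes from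
    \<open>\<bar>F\<bar> \<le> w ^ n * M\<close>, that is, \<open>w ^ (n - 1)\<close> is at least
    \<open>\<bar>F\<bar> / M\<close> to the power \<open>1 - a\<close>, combined with the lower
    bound \<open>m\<close> for \<open>q\<close>.\<close>
  define a where "a = 1 / real n"
  define C where "C = M powr (1 - a) / m"
  have bound: "norm (inverse (deriv f z)) \<le> C * norm (f z - f x) powr (a - 1)"
    if z: "z \<in> ball x (min r s)" "z \<noteq> x" for z
  proof -
    define w where "w = norm (z - x)"
    have w: "w > 0" using z by (simp add: w_def)
    have zr: "z \<in> ball x r" and zs: "dist z x < s" using z by (auto simp: dist_commute)
    note qg = s(2)[OF z(2) zs]
    have Fz: "norm (F z) = w ^ n * norm (g z)"
      using g(2)[OF zr] by (simp add: w_def norm_mult norm_power)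
    have "norm (F z) > 0" using Fz w g(3)[OF zr] by simp
    have le: "norm (F z) \<le> w ^ n * M"
      unfolding Fz using qg w by (intro mult_left_mono) auto
    \<comment> \<open>A nonpositive exponent reverses the inequality between the positive
      bases.\<close>
    have "a - 1 \<le> 0" using n by (simp add: a_def)
    with le \<open>norm (F z) > 0\<close> have "(w ^ n * M) powr (a - 1) \<le> norm (F z) powr (a - 1)"
      by (intro powr_mono2') auto
    moreover have "(w ^ n * M) powr (a - 1) = M powr (a - 1) / w ^ (n - 1)"
    proof -
      have "(w ^ n * M) powr (a - 1) = (w ^ n) powr (a - 1) * M powr (a - 1)"
        using w M by (simp add: powr_mult)
      also have "(w ^ n) powr (a - 1) = w powr (real n * (a - 1))"
        using w by (simp add: powr_powr flip: powr_realpow)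
      also have "real n * (a - 1) = - real (n - 1)"
        using n by (simp add: a_def field_simps of_nat_diff)
      also have "w powr - real (n - 1) = 1 / w ^ (n - 1)"
        using w by (simp add: powr_minus powr_realpow field_simps)
      finally show ?thesis by simp
    qed
    ultimately have *: "M powr (a - 1) / w ^ (n - 1) \<le> norm (F z) powr (a - 1)" by simp
    have "norm (inverse (deriv f z)) = 1 / (w ^ (n - 1) * norm (q z))"
      using deriv_f[OF zr] by (simp add: norm_inverse norm_mult norm_power w_def inverse_eq_divide norm_divide)
    also have "\<dots> \<le> 1 / (w ^ (n - 1) * m)"
      using w m qg by (intro divide_left_mono mult_left_mono mult_pos_pos) auto
    also have "\<dots> = C * (M powr (a - 1) / w ^ (n - 1))"
      using M m w by (simp add: C_def field_simps flip: powr_add)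
    also have "\<dots> \<le> C * norm (F z) powr (a - 1)"
      using * M m by (intro mult_left_mono) (auto simp: C_def)
    finally show ?thesis by (simp add: F_def)
  qed
  show ?thesis
    by (rule that[of a C "min r s"]) (use n M m r s(1) bound in \<open>auto simp: a_def C_def\<close>)
qed

section \<open>Critical points of h and the size of g in the half-strip\<close>

text \<open>The derivative is the denominator of \<open>gfun\<close>, so lower bounds for it become
  upper bounds for g.\<close>

lemma hfun_has_field_derivative:
  "(hfun \<rho> has_field_derivative \<xi> + of_real \<rho> * sinh \<xi> - \<i> * of_real pi) (at \<xi>)"
  unfolding hfun_def by (auto intro!: derivative_eq_intros)

lemma Re_sinh: "Re (sinh z) = sinh (Re z) * cos (Im z)"
  and Im_sinh: "Im (sinh z) = cosh (Re z) * sin (Im z)"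
  by (simp_all add: sinh_def cosh_def Re_exp Im_exp field_simps)

text \<open>Writing \<open>\<xi> = a + i (pi - u)\<close>, a zero means \<open>a = \<rho> * sinh a * cos u\<close> and
  \<open>u = \<rho> * cosh a * sin u\<close>. The first equation forces \<open>cos u > 0\<close>, and the quotient of the two reads
  \<open>tanh a / a = tan u / u\<close>, where the left-hand side is below 1 and the right-hand side above.\<close>

lemma hfun_deriv_nonzero:
  assumes \<rho>: "\<rho> > 0" and \<xi>: "Re \<xi> > 0" "0 < Im \<xi>" "Im \<xi> < pi"
  shows "\<xi> + of_real \<rho> * sinh \<xi> - \<i> * of_real pi \<noteq> 0"
proof
  assume z: "\<xi> + of_real \<rho> * sinh \<xi> - \<i> * of_real pi = 0"
  define a where "a = Re \<xi>"
  define u where "u = pi - Im \<xi>"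
  have a: "a > 0" and u: "0 < u" "u < pi" using \<xi> by (auto simp: a_def u_def)
  have sc: "sin (Im \<xi>) = sin u" "cos (Im \<xi>) = - cos u" by (auto simp: u_def)
  have re: "a = \<rho> * (sinh a * cos u)"
    using arg_cong[OF z, of Re] by (simp add: Re_sinh sc a_def)
  have im: "u = \<rho> * (cosh a * sin u)"
    using arg_cong[OF z, of Im] by (simp add: Im_sinh sc(1) a_def) (simp add: u_def)
  have su: "sin u > 0" using u by (simp add: sin_gt_zero)
  have sh: "sinh a > 0" using a by simp
  have "\<rho> * (sinh a * cos u) > 0" using re a by simp
  then have cu: "cos u > 0" using \<rho> sh by (simp add: zero_less_mult_iff)
  have "u * cos u * sinh a < sin u * (a * cosh a)"
    using mult_strict_mono[OF x_cos_less_sin[OF u] sinh_less_x_cosh[OF a]] su sh by simp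
  then have "u * cos u * sinh a * \<rho> < sin u * (a * cosh a) * \<rho>"
    using \<rho> by (rule mult_strict_right_mono)
  also have "\<dots> = a * u" using im by (simp add: mult_ac)
  also have "\<dots> = u * cos u * sinh a * \<rho>" using re by (simp add: mult_ac)
  finally show False by simp
qed

text \<open>Reverse triangle inequality for the two exponentials, whose norms depend on
  \<open>Re z\<close> only.\<close>

lemma norm_sinh_ge: "sinh (Re z) \<le> norm (sinh z)" if "Re z \<ge> 0" for z :: complex
proof -
  have "norm (exp z) - norm (exp (- z)) \<le> norm (exp z - exp (- z))"
    by (rule norm_triangle_ineq2)
  then show ?thesis by (simp add: sinh_def field_simps norm_divide norm_mult scaleR_conv_of_real)
qed

text \<open>In the strip \<open>\<xi> - \<i> * pi\<close> grows linearly with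
  \<open>Re \<xi>\<close> but \<open>sinh \<xi>\<close> exponentially. Far to the right the
  denominator therefore keeps at least half of the norm of
  \<open>\<rho> * sinh \<xi>\<close>.\<close>

lemma gfun_bounded_at_right:
  assumes \<rho>: "\<rho> > 0"
  obtains A where "\<And>\<xi>. Re \<xi> \<ge> A \<Longrightarrow> 0 < Im \<xi> \<Longrightarrow> Im \<xi> < pi \<Longrightarrow> norm (gfun \<xi> \<rho>) \<le> 2 / \<rho>"
proof -
  have "filterlim (\<lambda>x::real. \<rho> / 2 * sinh x - x - pi) at_top at_top"
    using \<rho> unfolding sinh_field_def by real_asymp
  \<comment> \<open>The condition \<open>1 \<le> x\<close> ensures
    \<open>sinh \<xi> \<noteq> 0\<close>, so that it can be cancelled in the final quotient.\<close>
  then have "eventually (\<lambda>x::real. 0 \<le> \<rho> / 2 * sinh x - x - pi \<and> 1 \<le> x) at_top"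
    by (intro eventually_conj eventually_ge_at_top) (simp only: filterlim_at_top)
  then obtain A where A: "\<And>x. x \<ge> A \<Longrightarrow> 0 \<le> \<rho> / 2 * sinh x - x - pi \<and> 1 \<le> x"
    unfolding eventually_at_top_linorder by auto
  have "norm (gfun \<xi> \<rho>) \<le> 2 / \<rho>" if \<xi>: "Re \<xi> \<ge> A" "0 < Im \<xi>" "Im \<xi> < pi" for \<xi>
  proof -
    have x: "Re \<xi> + pi \<le> \<rho> / 2 * sinh (Re \<xi>)" "1 \<le> Re \<xi>" using A[OF \<xi>(1)] by auto
    have s: "sinh (Re \<xi>) \<le> norm (sinh \<xi>)" using norm_sinh_ge x by simp
    have spos: "norm (sinh \<xi>) > 0" using s x sinh_real_pos_iff[of "Re \<xi>"] by linarith
    have "norm (\<xi> - \<i> * of_real pi) \<le> \<bar>Re (\<xi> - \<i> * of_real pi)\<bar> + \<bar>Im (\<xi> - \<i> * of_real pi)\<bar>"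
      by (rule cmod_le)
    also have "\<dots> \<le> Re \<xi> + pi" using \<xi> x by simp
    also have "\<dots> \<le> \<rho> / 2 * norm (sinh \<xi>)"
      using x(1) s \<rho> by (meson half_gt_zero le_less mult_left_mono order_trans)
    finally have "norm (\<xi> - \<i> * of_real pi) \<le> \<rho> / 2 * norm (sinh \<xi>)" .
    moreover have "\<rho> * norm (sinh \<xi>) - norm (\<xi> - \<i> * of_real pi)
        \<le> norm (\<xi> + of_real \<rho> * sinh \<xi> - \<i> * of_real pi)"
      using norm_diff_ineq[of "of_real \<rho> * sinh \<xi>" "\<xi> - \<i> * of_real pi"] \<rho>
      by (simp add: norm_mult add.commute add_diff_eq)
    ultimately have "\<rho> / 2 * norm (sinh \<xi>) \<le> norm (\<xi> + of_real \<rho> * sinh \<xi> - \<i> * of_real pi)"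
      by linarith
    then have "norm (gfun \<xi> \<rho>) \<le> norm (sinh \<xi>) / (\<rho> / 2 * norm (sinh \<xi>))"
      unfolding gfun_def norm_divide using \<rho> spos by (intro frac_le) auto
    also have "\<dots> = 2 / \<rho>" using spos \<rho> by (simp add: field_simps)
    finally show ?thesis .
  qed
  then show ?thesis by (rule that)
qed

lemma gfun_eq_inverse_deriv: "gfun z \<rho> = sinh z * inverse (deriv (hfun \<rho>) z)"
  using DERIV_imp_deriv[OF hfun_has_field_derivative[of \<rho> z]] by (simp add: gfun_def divide_inverse)

section \<open>Integrability of g along the steepest descent path\<close>

text \<open>The parameter 0 is excluded because the denominator vanishes at the saddle point;
  afterwards the path stays in the open half-strip, where it has no zero.\<close>

lemma continuous_on_gfun_path:
  assumes \<rho>: "\<rho> > 0" and path: "steepest_descent_path \<rho> \<xi>"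
  shows "continuous_on {0<..} (\<lambda>\<tau>. gfun (\<xi> \<tau>) \<rho>)"
proof -
  have "continuous_on {0<..} \<xi>"
    using path by (auto simp: steepest_descent_path_def intro: continuous_on_subset)
  then show ?thesis
    using path hfun_deriv_nonzero[OF \<rho>] unfolding gfun_def steepest_descent_path_def
    by (intro continuous_intros) auto
qed

text \<open>Three ranges of \<open>\<tau>\<close> are combined: near 0 the local bound at the saddle
  point, on a compact interval continuity, and beyond it the bound far to the right.\<close>

lemma gfun_path_bound:
  assumes \<rho>: "\<rho> > 0" and path: "steepest_descent_path \<rho> \<xi>"
  obtains a C D where "a > 0" "\<And>\<tau>. \<tau> > 0 \<Longrightarrow> norm (gfun (\<xi> \<tau>) \<rho>) \<le> C * \<tau> powr (a - 1) + D"
proof -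
  define X where "X = saddle \<rho>"
  have cont: "continuous_on {0..} \<xi>" and \<xi>0: "\<xi> 0 = X"
    and h: "\<And>\<tau>. \<tau> \<ge> 0 \<Longrightarrow> hfun \<rho> (\<xi> \<tau>) - hfun \<rho> X = of_real \<tau>"
    and strip: "\<And>\<tau>. \<tau> > 0 \<Longrightarrow> Re (\<xi> \<tau>) > 0 \<and> 0 < Im (\<xi> \<tau>) \<and> Im (\<xi> \<tau>) < pi"
    and lim: "filterlim (\<lambda>\<tau>. Re (\<xi> \<tau>)) at_top at_top"
    using path by (auto simp: steepest_descent_path_def X_def)
  have hol: "hfun \<rho> holomorphic_on UNIV"
    using hfun_has_field_derivative holomorphic_on_open by blast
  have "\<not> hfun \<rho> constant_on UNIV"
  proof
    assume "hfun \<rho> constant_on UNIV"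
    then have "hfun \<rho> (\<xi> 1) = hfun \<rho> X" by (auto simp: constant_on_def)
    with h[of 1] show False by simp
  qed
  \<comment> \<open>The order of the zero of \<open>hfun \<rho> z - hfun \<rho> X\<close> at
    \<open>X\<close> is 2 for \<open>\<rho> \<noteq> 1\<close> and 4 for \<open>\<rho> = 1\<close>;
    an unspecified exponent \<open>a\<close> handles all cases of the saddle point together.\<close>
  from inverse_deriv_bound_near_point[OF hol open_UNIV connected_UNIV UNIV_I[of X] this]
  obtain a C r where a: "a > 0" and C: "C > 0" and r: "r > 0"
    and near: "\<And>z. z \<in> ball X r \<Longrightarrow> z \<noteq> X \<Longrightarrow>
      norm (inverse (deriv (hfun \<rho>) z)) \<le> C * norm (hfun \<rho> z - hfun \<rho> X) powr (a - 1)"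
    by metis
  have "compact (sinh ` cball X r)"
    by (intro compact_continuous_image continuous_intros compact_cball)
  then obtain K where K: "K > 0" "\<And>z. z \<in> cball X r \<Longrightarrow> norm (sinh z) \<le> K"
    using compact_imp_bounded bounded_pos by (metis imageI)
  obtain e where e: "e > 0" "\<And>\<tau>. 0 \<le> \<tau> \<Longrightarrow> \<tau> < e \<Longrightarrow> dist (\<xi> \<tau>) X < r"
    using cont r \<xi>0 unfolding continuous_on_iff by (force simp: dist_real_def)
  \<comment> \<open>Along the path h exceeds its value at the saddle point by exactly
    \<open>\<tau>\<close>, which turns the local bound into a power of
    \<open>\<tau>\<close>.\<close>
  have small: "norm (gfun (\<xi> \<tau>) \<rho>) \<le> K * C * \<tau> powr (a - 1)" if \<tau>: "0 < \<tau>" "\<tau> < e" for \<tau>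
  proof -
    have d: "dist (\<xi> \<tau>) X < r" using e \<tau> by simp
    have "\<xi> \<tau> \<noteq> X" using h[of \<tau>] \<tau> by auto
    then have "norm (inverse (deriv (hfun \<rho>) (\<xi> \<tau>))) \<le> C * \<tau> powr (a - 1)"
      using near[of "\<xi> \<tau>"] h[of \<tau>] d \<tau> by (simp add: dist_commute)
    moreover have "norm (sinh (\<xi> \<tau>)) \<le> K"
      using d by (intro K(2)) (simp add: dist_commute)
    ultimately show ?thesis
      unfolding gfun_eq_inverse_deriv norm_mult mult.assoc using K(1) by (intro mult_mono) auto
  qed
  obtain A where A: "\<And>\<xi>. Re \<xi> \<ge> A \<Longrightarrow> 0 < Im \<xi> \<Longrightarrow> Im \<xi> < pi \<Longrightarrow> norm (gfun \<xi> \<rho>) \<le> 2 / \<rho>"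
    using gfun_bounded_at_right[OF \<rho>] by metis
  have "eventually (\<lambda>\<tau>. Re (\<xi> \<tau>) \<ge> A) at_top"
    using lim by (simp only: filterlim_at_top)
  then obtain T where T: "\<And>\<tau>. \<tau> \<ge> T \<Longrightarrow> Re (\<xi> \<tau>) \<ge> A"
    unfolding eventually_at_top_linorder by auto
  \<comment> \<open>For \<open>T < e\<close> this interval is empty, and the two outer ranges
    overlap.\<close>
  have "continuous_on {e..T} (\<lambda>\<tau>. gfun (\<xi> \<tau>) \<rho>)"
    using e(1) by (intro continuous_on_subset[OF continuous_on_gfun_path[OF \<rho> path]]) auto
  then have "compact ((\<lambda>\<tau>. gfun (\<xi> \<tau>) \<rho>) ` {e..T})"
    by (intro compact_continuous_image compact_Icc)
  then obtain B where B: "B > 0" "\<And>\<tau>. \<tau> \<in> {e..T} \<Longrightarrow> norm (gfun (\<xi> \<tau>) \<rho>) \<le> B"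
    using compact_imp_bounded bounded_pos by (metis imageI)
  have "norm (gfun (\<xi> \<tau>) \<rho>) \<le> K * C * \<tau> powr (a - 1) + (2 / \<rho> + B)" if \<tau>: "\<tau> > 0" for \<tau>
  proof -
    \<comment> \<open>All summands of the bound are nonnegative, so in each range one of them
      suffices.\<close>
    have nn: "0 \<le> K * C * \<tau> powr (a - 1)" "0 \<le> 2 / \<rho>" "0 \<le> B"
      using K(1) C \<rho> B(1) by auto
    consider "\<tau> < e" | "\<tau> \<in> {e..T}" | "\<tau> \<ge> T" by fastforce
    then show ?thesis
    proof cases
      case 1
      then show ?thesis using small[OF \<tau>] nn by linarith
    next
      case 2
      then show ?thesis using B(2)[OF 2] nn by linarith
    next
      case 3
      then show ?thesis using A[OF T[OF 3]] strip[OF \<tau>] nn by linarith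
    qed
  qed
  then show ?thesis using that a by blast
qed

text \<open>The complex integral has to be shown to converge absolutely, real part included: the integral
  of a non-integrable function is 0 by convention, and the hypotheses on \<open>delta\<close> only control
  the imaginary part.\<close>

lemma set_integrable_Laplace_gfun_path:
  assumes \<rho>: "\<rho> > 0" and path: "steepest_descent_path \<rho> \<xi>" and t: "t > 0"
  shows "set_integrable lborel {0<..} (\<lambda>\<tau>. of_real (exp (- \<tau> / t)) * gfun (\<xi> \<tau>) \<rho>)"
proof -
  obtain a C D where a: "a > 0"
    and bound: "\<And>\<tau>. \<tau> > 0 \<Longrightarrow> norm (gfun (\<xi> \<tau>) \<rho>) \<le> C * \<tau> powr (a - 1) + D"
    using gfun_path_bound[OF \<rho> path] by metis
  \<comment> \<open>The exponent \<open>1 - 1\<close> brings the constant \<open>D\<close> into the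
    form of \<open>Laplace_powr\<close> with exponent parameter 1.\<close>
  have "set_integrable lborel {0<..} (\<lambda>\<tau>. C * (exp (- \<tau> / t) * \<tau> powr (a - 1)) + D * (exp (- \<tau> / t) * \<tau> powr (1 - 1)))"
    by (intro set_integral_add(1) set_integrable_mult_right Laplace_powr(1)) (use a t in auto)
  then show ?thesis
  proof (rule set_integrable_bound)
    have "continuous_on {0<..} (\<lambda>\<tau>. of_real (exp (- \<tau> / t)) * gfun (\<xi> \<tau>) \<rho>)"
      using t by (intro continuous_intros continuous_on_gfun_path[OF \<rho> path]) auto
    then show "set_borel_measurable lborel {0<..} (\<lambda>\<tau>. of_real (exp (- \<tau> / t)) * gfun (\<xi> \<tau>) \<rho>)"
      using set_measurable_continuous_on[OF borel_open[OF open_greaterThan]]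
      by (fastforce simp: set_borel_measurable_def)
    show "AE \<tau> in lborel. \<tau> \<in> {0<..} \<longrightarrow> norm (of_real (exp (- \<tau> / t)) * gfun (\<xi> \<tau>) \<rho>) \<le>
        norm (C * (exp (- \<tau> / t) * \<tau> powr (a - 1)) + D * (exp (- \<tau> / t) * \<tau> powr (1 - 1)))"
    proof (intro AE_I2 impI)
      fix \<tau> :: real assume "\<tau> \<in> {0<..}"
      then have \<tau>: "\<tau> > 0" by simp
      have "norm (of_real (exp (- \<tau> / t)) * gfun (\<xi> \<tau>) \<rho>) \<le> exp (- \<tau> / t) * (C * \<tau> powr (a - 1) + D)"
        using bound[OF \<tau>] by (simp add: norm_mult)
      also have "\<dots> = C * (exp (- \<tau> / t) * \<tau> powr (a - 1)) + D * (exp (- \<tau> / t) * \<tau> powr (1 - 1))"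
        using \<tau> by (simp add: algebra_simps)
      finally show "norm (of_real (exp (- \<tau> / t)) * gfun (\<xi> \<tau>) \<rho>) \<le>
          norm (C * (exp (- \<tau> / t) * \<tau> powr (a - 1)) + D * (exp (- \<tau> / t) * \<tau> powr (1 - 1)))"
        by simp
    qed
  qed
qed

lemma set_integral_Im:
  assumes "set_integrable M A f"
  shows "set_integrable M A (\<lambda>x. Im (f x))" and "(LINT x:A|M. Im (f x)) = Im (LINT x:A|M. f x)"
  using integrable_bounded_linear[OF bounded_linear_Im assms[unfolded set_integrable_def]]
    integral_bounded_linear[OF bounded_linear_Im assms[unfolded set_integrable_def]]
  by (simp_all add: set_integrable_def set_lebesgue_integral_def)

section \<open>Integral representation and limit of \<open>vartheta_max\<close>\<close>

text \<open>The total mass of the weight, which is the normalising factor in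
  \<open>vartheta\<close>.\<close>

lemma Laplace_inverse_sqrt:
  fixes t :: real
  assumes "t > 0"
  shows "(LBINT \<tau>:{0<..}. exp (- \<tau> / t) * \<tau> powr (1 / 2 - 1)) = sqrt (pi * t)"
  using Laplace_powr(2)[of "1 / 2" t] assms
  by (simp add: Gamma_one_half_real powr_half_sqrt real_sqrt_mult)

lemma Gamma_three_halves: "Gamma (3 / 2 :: real) = sqrt pi / 2"
  using Gamma_plus1[of "1 / 2 :: real"] nonpos_Ints_nonpos[of "1 / 2 :: real"]
  by (auto simp: Gamma_one_half_real)

text \<open>Below 35 the minimum is \<open>\<tau> / 35\<close>, which raises the exponent parameter
  from 1/2 to 3/2 and yields the linear term and the \<open>Ei\<close> term; from 35 on it is 1 and
  yields the \<open>erfc\<close> term.\<close>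

lemma vartheta_max_eq_integral:
  assumes t: "t > 0"
  shows "set_integrable lborel {0<..} (\<lambda>\<tau>. exp (- \<tau> / t) * \<tau> powr (1 / 2 - 1) * min 1 (\<tau> / 35))"
    and "(LBINT \<tau>:{0<..}. exp (- \<tau> / t) * \<tau> powr (1 / 2 - 1) * min 1 (\<tau> / 35)) =
      sqrt (pi * t) * vartheta_max t"
proof -
  define v where "v = (\<lambda>a \<tau>. exp (- \<tau> / t) * \<tau> powr (a - 1))"
  define f where "f = (\<lambda>\<tau>. v (1 / 2) \<tau> * min 1 (\<tau> / 35))"
  have un: "{0<..} = {0<..<35} \<union> {35::real..}" by auto
  have v: "set_integrable lborel {0<..<35} (v a)" "set_integrable lborel {35..} (v a)" if "a > 0" for a
    unfolding v_def by (rule set_integrable_subset[OF Laplace_powr(1)[OF that t]]; auto)+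
  have f1: "f \<tau> = 1 / 35 * v (3 / 2) \<tau>" if "\<tau> \<in> {0<..<35}" for \<tau>
  proof -
    have "\<tau> powr (1 / 2) = \<tau> powr (1 / 2 - 1) * \<tau>"
      using that powr_add[of \<tau> "1 / 2 - 1" 1] by simp
    then show ?thesis using that by (simp add: f_def v_def min_def)
  qed
  have f2: "f \<tau> = v (1 / 2) \<tau>" if "\<tau> \<in> {35..}" for \<tau>
    using that by (simp add: f_def min_def)
  have "set_integrable lborel {0<..<35} f \<longleftrightarrow> set_integrable lborel {0<..<35} (\<lambda>\<tau>. 1 / 35 * v (3 / 2) \<tau>)"
    by (intro set_integrable_cong refl f1)
  then have i1: "set_integrable lborel {0<..<35} f"
    using v(1)[of "3 / 2"] by simp
  have "set_integrable lborel {35..} f \<longleftrightarrow> set_integrable lborel {35..} (v (1 / 2))"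
    by (intro set_integrable_cong refl f2)
  then have i2: "set_integrable lborel {35..} f"
    using v(2)[of "1 / 2"] by simp
  have "set_integrable lborel {0<..} f"
    unfolding un using i1 i2 by (intro set_integrable_Un) auto
  then show "set_integrable lborel {0<..} (\<lambda>\<tau>. exp (- \<tau> / t) * \<tau> powr (1 / 2 - 1) * min 1 (\<tau> / 35))"
    by (simp add: f_def v_def)
  \<comment> \<open>The integral over the bounded interval is obtained as the full Laplace integral
    minus its tail.\<close>
  have "(LBINT \<tau>:{0<..}. v (3 / 2) \<tau>) = (LBINT \<tau>:{0<..<35}. v (3 / 2) \<tau>) + (LBINT \<tau>:{35..}. v (3 / 2) \<tau>)"
    unfolding un using v[of "3 / 2"] by (intro set_integral_Un) auto
  then have "(LBINT \<tau>:{0<..<35}. v (3 / 2) \<tau>) =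
      sqrt pi / 2 * t powr (3 / 2) - 35 powr (3 / 2) * Ei (1 - 3 / 2) (35 / t)"
    using Laplace_powr(2)[of "3 / 2" t] Laplace_powr_Ici_eq_Ei[of "3 / 2" 35 t] t
    unfolding v_def Gamma_three_halves by simp
  moreover have "t powr (3 / 2) = t * sqrt t" "35 powr (3 / 2) = 35 * sqrt (35::real)"
    using t powr_add[of t 1 "1 / 2"] powr_add[of "35::real" 1 "1 / 2"] by (simp_all add: powr_half_sqrt)
  ultimately have I1: "(LBINT \<tau>:{0<..<35}. v (3 / 2) \<tau>) =
      sqrt pi / 2 * (t * sqrt t) - 35 * sqrt 35 * Ei (- 1 / 2) (35 / t)"
    by simp
  have I2: "(LBINT \<tau>:{35..}. v (1 / 2) \<tau>) = sqrt (pi * t) * erfc (sqrt (35 / t))"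
    unfolding v_def using t by (intro Laplace_inverse_sqrt_Ici_eq_erfc) auto
  have "(LBINT \<tau>:{0<..}. f \<tau>) = (LBINT \<tau>:{0<..<35}. f \<tau>) + (LBINT \<tau>:{35..}. f \<tau>)"
    unfolding un using i1 i2 by (intro set_integral_Un) auto
  also have "(LBINT \<tau>:{0<..<35}. f \<tau>) = (LBINT \<tau>:{0<..<35}. 1 / 35 * v (3 / 2) \<tau>)"
    by (rule set_lebesgue_integral_cong) (use f1 in auto)
  also have "(LBINT \<tau>:{35..}. f \<tau>) = (LBINT \<tau>:{35..}. v (1 / 2) \<tau>)"
    by (rule set_lebesgue_integral_cong) (use f2 in auto)
  finally have "(LBINT \<tau>:{0<..}. f \<tau>) =
      1 / 35 * (sqrt pi / 2 * (t * sqrt t) - 35 * sqrt 35 * Ei (- 1 / 2) (35 / t)) +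
      sqrt (pi * t) * erfc (sqrt (35 / t))"
    by (simp add: I1 I2)
  also have "\<dots> = sqrt (pi * t) * vartheta_max t"
  proof -
    \<comment> \<open>This produces the coefficient of the \<open>Ei\<close> term; on the other side
      it is \<open>35 * sqrt 35\<close> divided by 35.\<close>
    have "sqrt (pi * t) * sqrt (35 / (pi * t)) = sqrt 35"
      using t by (simp flip: real_sqrt_mult)
    then have "sqrt (pi * t) * vartheta_max t =
        sqrt (pi * t) * t / 70 - sqrt 35 * Ei (- 1 / 2) (35 / t) + sqrt (pi * t) * erfc (sqrt (35 / t))"
      unfolding vartheta_max_def distrib_left right_diff_distrib mult.assoc[symmetric] by simp
    then show ?thesis by (simp add: real_sqrt_mult)
  qed
  finally show "(LBINT \<tau>:{0<..}. exp (- \<tau> / t) * \<tau> powr (1 / 2 - 1) * min 1 (\<tau> / 35)) =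
      sqrt (pi * t) * vartheta_max t"
    by (simp add: f_def v_def)
qed

text \<open>The defect \<open>1 - vartheta_max t\<close> is the average of a function vanishing from
  35 on. Its unnormalised integral stays bounded in \<open>t\<close>, while the mass
  \<open>sqrt (pi * t)\<close> tends to infinity.\<close>

lemma vartheta_max_tendsto_1: "(vartheta_max \<longlongrightarrow> 1) at_top"
proof -
  define w where "w = (\<lambda>t \<tau>::real. exp (- \<tau> / t) * \<tau> powr (1 / 2 - 1))"
  have w: "set_integrable lborel {0<..} (w t)" "(LBINT \<tau>:{0<..}. w t \<tau>) = sqrt (pi * t)" if "t > 0" for t
    using Laplace_powr(1)[of "1 / 2" t] Laplace_inverse_sqrt[of t] that by (auto simp: w_def)
  have bounds: "1 - exp 35 / sqrt t \<le> vartheta_max t \<and> vartheta_max t \<le> 1" if t: "t > 0" for t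
  proof -
    have m: "set_integrable lborel {0<..} (\<lambda>\<tau>. w t \<tau> * min 1 (\<tau> / 35))"
      "(LBINT \<tau>:{0<..}. w t \<tau> * min 1 (\<tau> / 35)) = sqrt (pi * t) * vartheta_max t"
      unfolding w_def using vartheta_max_eq_integral[OF t] by simp_all
    have s: "sqrt (pi * t) > 0" using t by simp
    have "(LBINT \<tau>:{0<..}. w t \<tau> * min 1 (\<tau> / 35)) \<le> (LBINT \<tau>:{0<..}. w t \<tau>)"
      by (rule set_integral_mono) (use m w[OF t] in \<open>auto simp: w_def mult_left_le\<close>)
    then have "vartheta_max t \<le> 1"
      using s by (simp add: m(2) w(2)[OF t])
    \<comment> \<open>The majorant \<open>exp 35 * w 1 \<tau>\<close> does not depend on
      \<open>t\<close>, its integral is known, and below 35 the factor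
      \<open>exp (35 - \<tau>)\<close> is at least 1.\<close>
    have "(LBINT \<tau>:{0<..}. w t \<tau> - w t \<tau> * min 1 (\<tau> / 35)) \<le> (LBINT \<tau>:{0<..}. exp 35 * w 1 \<tau>)"
    proof (rule set_integral_mono)
      fix \<tau> :: real assume "\<tau> \<in> {0<..}"
      then have \<tau>: "\<tau> > 0" by simp
      show "w t \<tau> - w t \<tau> * min 1 (\<tau> / 35) \<le> exp 35 * w 1 \<tau>"
      proof (cases "\<tau> < 35")
        case True
        have "exp (- \<tau> / t) \<le> 1" using \<tau> t by simp
        also have "1 \<le> exp (35 - \<tau>)" using True by simp
        finally have "exp (- \<tau> / t) \<le> exp 35 * exp (- \<tau> / 1)" by (simp flip: exp_add)
        then have "w t \<tau> \<le> exp 35 * w 1 \<tau>"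
          unfolding w_def mult.assoc[symmetric] by (intro mult_right_mono) auto
        moreover have "0 \<le> w t \<tau> * min 1 (\<tau> / 35)" using \<tau> by (simp add: w_def)
        ultimately show ?thesis by linarith
      next
        case False
        then show ?thesis by (simp add: w_def min_def)
      qed
    qed (use m(1) w t in auto)
    also have "(LBINT \<tau>:{0<..}. w t \<tau> - w t \<tau> * min 1 (\<tau> / 35)) = sqrt (pi * t) * (1 - vartheta_max t)"
      using set_integral_diff(2)[OF w(1)[OF t] m(1)] by (simp add: m(2) w(2)[OF t] algebra_simps)
    also have "(LBINT \<tau>:{0<..}. exp 35 * w 1 \<tau>) = exp 35 * sqrt pi"
      by (simp add: w(2))
    finally have "sqrt t * (1 - vartheta_max t) \<le> exp 35"
      by (simp add: real_sqrt_mult mult.commute mult.left_commute)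
    then have "1 - exp 35 / sqrt t \<le> vartheta_max t"
      using t by (simp add: field_simps)
    with \<open>vartheta_max t \<le> 1\<close> show ?thesis by simp
  qed
  have "((\<lambda>t::real. 1 - exp 35 / sqrt t) \<longlongrightarrow> 1) at_top"
    by real_asymp
  then show ?thesis
  proof (rule tendsto_sandwich[rotated 2, where h = "\<lambda>_. 1"])
    show "eventually (\<lambda>t. 1 - exp 35 / sqrt t \<le> vartheta_max t) at_top"
      "eventually (\<lambda>t. vartheta_max t \<le> 1) at_top"
      by (rule eventually_mono[OF eventually_gt_at_top[of 0]]; use bounds in blast)+
  qed auto
qed

section \<open>The bound on \<open>vartheta\<close>\<close>

text \<open>Inserting the defining relation of \<open>delta\<close> into the integral and
  subtracting the mass of the weight leaves \<open>sqrt (pi * t) * vartheta \<xi> t \<rho>\<close>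
  as the integral of \<open>w * delta\<close>, to which both hypotheses on \<open>delta\<close>
  apply.\<close>

lemma abs_vartheta_le:
  assumes \<rho>: "\<rho> > 0" and t: "t > 0" and path: "steepest_descent_path \<rho> (\<xi> \<rho>)"
    and le_1: "\<And>\<tau>. \<tau> > 0 \<Longrightarrow> \<bar>delta \<xi> \<tau> \<rho>\<bar> \<le> 1"
    and le_linear: "\<And>\<tau>. \<tau> > 0 \<Longrightarrow> \<bar>delta \<xi> \<tau> \<rho>\<bar> \<le> 1 / 35 * \<tau>"
  shows "\<bar>vartheta \<xi> t \<rho>\<bar> \<le> vartheta_max t"
proof -
  define w where "w = (\<lambda>\<tau>::real. exp (- \<tau> / t) * \<tau> powr (1 / 2 - 1))"
  define G where "G = (\<lambda>\<tau>. of_real (exp (- \<tau> / t)) * gfun (\<xi> \<rho> \<tau>) \<rho>)"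
  have g0: "g0 \<rho> > 0" using \<rho> by (rule g0_pos)
  have w: "set_integrable lborel {0<..} w" "(LBINT \<tau>:{0<..}. w \<tau>) = sqrt (pi * t)"
    using Laplace_powr(1)[of "1 / 2" t] Laplace_inverse_sqrt[of t] t by (auto simp: w_def)
  have m: "set_integrable lborel {0<..} (\<lambda>\<tau>. w \<tau> * min 1 (\<tau> / 35))"
    "(LBINT \<tau>:{0<..}. w \<tau> * min 1 (\<tau> / 35)) = sqrt (pi * t) * vartheta_max t"
    unfolding w_def using vartheta_max_eq_integral[OF t] by simp_all
  have G: "set_integrable lborel {0<..} G"
    unfolding G_def by (rule set_integrable_Laplace_gfun_path[OF \<rho> path t])
  have wd: "Im (G \<tau>) / g0 \<rho> - w \<tau> = w \<tau> * delta \<xi> \<tau> \<rho>" if "\<tau> \<in> {0<..}" for \<tau>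
  proof -
    have "w \<tau> = exp (- \<tau> / t) * (1 / sqrt \<tau>)"
      using that powr_minus_divide[of \<tau> "1 / 2"] by (simp add: w_def powr_half_sqrt)
    moreover have "Im (G \<tau>) = exp (- \<tau> / t) * (g0 \<rho> * (1 / sqrt \<tau>) * (1 + delta \<xi> \<tau> \<rho>))"
      using delta_eq[OF \<rho>, of \<tau> \<xi>] that by (simp add: G_def)
    ultimately show ?thesis using g0 by (simp add: distrib_left add_divide_distrib)
  qed
  \<comment> \<open>Integrability of \<open>w * delta\<close>, measurability included, is inherited
    from the integrand along the path.\<close>
  have "set_integrable lborel {0<..} (\<lambda>\<tau>. Im (G \<tau>) / g0 \<rho> - w \<tau>)"
    by (intro set_integral_diff(1) set_integrable_divide set_integral_Im(1) G w(1))
  also have "?this \<longleftrightarrow> set_integrable lborel {0<..} (\<lambda>\<tau>. w \<tau> * delta \<xi> \<tau> \<rho>)"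
    by (intro set_integrable_cong refl wd)
  finally have D: "set_integrable lborel {0<..} (\<lambda>\<tau>. w \<tau> * delta \<xi> \<tau> \<rho>)" .
  have "(LBINT \<tau>:{0<..}. w \<tau> * delta \<xi> \<tau> \<rho>) = (LBINT \<tau>:{0<..}. Im (G \<tau>) / g0 \<rho> - w \<tau>)"
    by (rule set_lebesgue_integral_cong) (use wd in auto)
  \<comment> \<open>Absolute convergence of the complex integral allows \<open>Im\<close> to be
    taken outside.\<close>
  also have "\<dots> = Im (LBINT \<tau>:{0<..}. G \<tau>) / g0 \<rho> - sqrt (pi * t)"
    using G by (subst set_integral_diff(2)) (auto simp: w set_integral_Im)
  also have "\<dots> = sqrt (pi * t) * vartheta \<xi> t \<rho>"
    using vartheta_eq[OF \<rho> t, of \<xi>] g0 by (simp add: G_def distrib_left add_divide_distrib)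
  finally have I: "(LBINT \<tau>:{0<..}. w \<tau> * delta \<xi> \<tau> \<rho>) = sqrt (pi * t) * vartheta \<xi> t \<rho>" .
  have le: "\<bar>w \<tau> * delta \<xi> \<tau> \<rho>\<bar> \<le> w \<tau> * min 1 (\<tau> / 35)" if "\<tau> \<in> {0<..}" for \<tau>
    using that le_1[of \<tau>] le_linear[of \<tau>] unfolding abs_mult
    by (intro mult_mono) (auto simp: w_def)
  have "(LBINT \<tau>:{0<..}. w \<tau> * delta \<xi> \<tau> \<rho>) \<le> (LBINT \<tau>:{0<..}. w \<tau> * min 1 (\<tau> / 35))"
    by (rule set_integral_mono[OF D m(1)]) (use le in \<open>auto dest: abs_le_D1\<close>)
  moreover have "- (LBINT \<tau>:{0<..}. w \<tau> * delta \<xi> \<tau> \<rho>) \<le> (LBINT \<tau>:{0<..}. w \<tau> * min 1 (\<tau> / 35))"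
    unfolding set_integral_uminus[OF D, symmetric]
    by (rule set_integral_mono[OF _ m(1)])
      (use le D in \<open>auto dest: abs_le_D2 simp: set_integrable_def\<close>)
  ultimately have "sqrt (pi * t) * \<bar>vartheta \<xi> t \<rho>\<bar> \<le> sqrt (pi * t) * vartheta_max t"
    unfolding I m(2) by (simp add: abs_if)
  then show ?thesis using t by simp
qed

theorem mainTheorem2:
  fixes \<xi> :: "real \<Rightarrow> real \<Rightarrow> complex"
  assumes path: "\<And>\<rho>. \<rho> > 0 \<Longrightarrow> steepest_descent_path \<rho> (\<xi> \<rho>)"
    and delta_le_1: "\<And>\<tau> \<rho>. \<tau> > 0 \<Longrightarrow> \<rho> > 0 \<Longrightarrow> \<bar>delta \<xi> \<tau> \<rho>\<bar> \<le> 1"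
    and delta_le_linear: "\<And>\<tau> \<rho>. \<tau> > 0 \<Longrightarrow> \<rho> > 0 \<Longrightarrow> \<bar>delta \<xi> \<tau> \<rho>\<bar> \<le> 1 / 35 * \<tau>"
  shows "(\<forall>t>0. \<forall>\<rho>>0. \<bar>vartheta \<xi> t \<rho>\<bar> \<le> vartheta_max t) \<and>
    (vartheta_max \<longlongrightarrow> 1) at_top"
  using abs_vartheta_le[OF _ _ path delta_le_1 delta_le_linear] vartheta_max_tendsto_1 by blast

end
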